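(* Let $Q$ and $C_X$ define a circularly symmetric Gaussian locally self-similar process with covariance $R_X(t,s)=Q(\sqrt{ts})\,C_X(t/s)$, $t,s>0$, and let $\Phi_{opt}$ be its optimal time-frequency kernel. Let $a,b\in\mathbb{R}$, and let $Z$ be a locally self-similar chirp process with chirp parameters $a,b$, i.e. a circularly symmetric Gaussian process with covariance $$R_Z(t,s)=Q(\sqrt{ts})\,C_X(t/s)\,(t/s)^{ia(\ln\sqrt{ts}-b)},\qquad t,s>0.$$ Then the optimal time-frequency kernel $\Phi_{c.opt}$ of $Z$ is $$\Phi_{c.opt}(t,\xi)=\Phi_{opt}\Big(t,\ \xi-\frac{a}{2\pi}\ln t\Big),\qquad (t,\xi)\in\mathbb{R}^+\times\mathbb{R}.$$
   Context: $^*$ denotes complex conjugation and $\mathbb{R}^+=(0,\infty)$. Locally self-similar process (LSSP): a process with covariance $R_X(t,s)=(ts)^Hq(\ln\sqrt{ts})\,C_X(t/s)=Q(\sqrt{ts})\,C_X(t/s)$, where $Q(t):=t^{2H}q(\ln t)$, $Q$ and $C_X$ are continuous and not identically zero, $C_X$ is nonnegative definite on the multiplicative group $\mathbb{R}^+$, and $C_X(1)=1$, so that $Q\ge0$. Circularly symmetric: $\{e^{i\alpha}Y(t)\}$ are identically distributed for all $\alpha\in[0,2\pi)$; consequently $E(Y(t))=0$ and $E(Y(t)Y(s))=0$. For a process $Y$ on $\mathbb{R}^+$ (here $Y=X$ or $Y=Z$), the scale invariant ambiguity function is the mean-square integral $A_Y(\theta,\tau)=\int_0^\infty Y(t\sqrt{\tau})\,Y^*(t/\sqrt{\tau})\,t^{-i2\pi\theta-1}\,dt$,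 $(\theta,\tau)\in\mathbb{R}\times\mathbb{R}^+$, and $A_{E,Y}=E\{A_Y\}$. The optimal ambiguity-domain kernel of $Y$ is $$\phi(\theta,\tau)=\frac{|A_{E,Y}(\theta,\tau)|^2}{E|A_Y(\theta,\tau)|^2}\,I_{U_Y}(\theta,\tau),\qquad U_Y=\{(\theta,\tau):E|A_Y(\theta,\tau)|^2>0\},$$ with $I_{U_Y}$ the indicator function of $U_Y$. The optimal time-frequency kernel of $Y$ is $$\Phi(t,\xi)=\int_0^\infty\int_{-\infty}^\infty\phi(\theta,\tau)\,t^{i2\pi\theta}\,\tau^{-i2\pi\xi-1}\,d\theta\,d\tau .$$ $\Phi_{opt}$ and $\Phi_{c.opt}$ denote this kernel for $Y=X$ and $Y=Z$ respectively. Standing assumptions: the mean-square integrals exist, expectation and integration may be interchanged in computing $E\{A_Y\}$ and $E|A_Y|^2$, and the deterministic integrals that appear (including the one defining the optimal time-frequency kernel) converge absolutely. *)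

theory Defs
  imports "HOL-Probability.Probability"
begin

text \<open>
  A process on the positive half-line is a function \<open>Y :: real \<Rightarrow> 'a \<Rightarrow> complex\<close> together with a
  probability space \<open>M\<close>; only its values at indices \<open>t > 0\<close> matter.
\<close>

definition second_order :: "'a measure \<Rightarrow> ('a \<Rightarrow> complex) \<Rightarrow> bool" where
  "second_order M W \<longleftrightarrow>
     W \<in> borel_measurable M \<and> integrable M (\<lambda>\<omega>. (cmod (W \<omega>))\<^sup>2)"

definition covariance ::
    "'a measure \<Rightarrow> (real \<Rightarrow> 'a \<Rightarrow> complex) \<Rightarrow> real \<Rightarrow> real \<Rightarrow> complex" where
  "covariance M Y t s =
     (LINT \<omega>|M. (Y t \<omega> - integral\<^sup>L M (Y t)) * cnj (Y s \<omega> - integral\<^sup>L M (Y s)))"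

definition has_covariance ::
    "'a measure \<Rightarrow> (real \<Rightarrow> 'a \<Rightarrow> complex) \<Rightarrow> (real \<Rightarrow> real \<Rightarrow> complex) \<Rightarrow> bool" where
  "has_covariance M Y R \<longleftrightarrow>
     (\<forall>t>0. second_order M (Y t)) \<and> (\<forall>t>0. \<forall>s>0. covariance M Y t s = R t s)"

text \<open>Real Gaussian variables; a point mass counts as Gaussian with variance zero.\<close>

definition gaussian_rv :: "'a measure \<Rightarrow> ('a \<Rightarrow> real) \<Rightarrow> bool" where
  "gaussian_rv M W \<longleftrightarrow> W \<in> borel_measurable M \<and>
     ((\<exists>\<mu> \<sigma>. \<sigma> > 0 \<and> distributed M lborel W (normal_density \<mu> \<sigma>)) \<or> (\<exists>\<mu>. AE \<omega> in M. W \<omega> = \<mu>))"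

text \<open>
  The functions \<open>Re (\<Sum>t\<in>S. c t * Y t)\<close> with complex coefficients \<open>c\<close> are exactly the real linear
  combinations of the real and imaginary parts of the \<open>Y t\<close>, so this says that these parts are
  jointly Gaussian.
\<close>

definition gaussian_process :: "'a measure \<Rightarrow> (real \<Rightarrow> 'a \<Rightarrow> complex) \<Rightarrow> bool" where
  "gaussian_process M Y \<longleftrightarrow>
     (\<forall>S c. finite S \<and> S \<subseteq> {0<..} \<longrightarrow> gaussian_rv M (\<lambda>\<omega>. Re (\<Sum>t\<in>S. c t * Y t \<omega>)))"

definition process_law ::
    "'a measure \<Rightarrow> (real \<Rightarrow> 'a \<Rightarrow> complex) \<Rightarrow> (real \<Rightarrow> complex) measure" where
  "process_law M Y = distr M (\<Pi>\<^sub>M t\<in>{0<..}. borel) (\<lambda>\<omega>. \<lambda>t\<in>{0<..}. Y t \<omega>)"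

definition circularly_symmetric :: "'a measure \<Rightarrow> (real \<Rightarrow> 'a \<Rightarrow> complex) \<Rightarrow> bool" where
  "circularly_symmetric M Y \<longleftrightarrow>
     (\<forall>t>0. Y t \<in> borel_measurable M) \<and>
     (\<forall>\<alpha>\<in>{0..<2 * pi}. process_law M (\<lambda>t \<omega>. exp (\<i> * of_real \<alpha>) * Y t \<omega>) = process_law M Y)"

definition mult_nonneg_definite :: "(real \<Rightarrow> complex) \<Rightarrow> bool" where
  "mult_nonneg_definite C \<longleftrightarrow>
     (\<forall>S c. finite S \<and> S \<subseteq> {0<..} \<longrightarrow>
        (\<Sum>x\<in>S. \<Sum>y\<in>S. c x * cnj (c y) * C (x / y)) \<in> \<real>\<^sub>\<ge>\<^sub>0)"

text \<open>
  Since \<open>C 1 = 1\<close>, the value \<open>Q t\<close> is the variance at time \<open>t\<close>; so taking \<open>q\<close> and \<open>Q\<close>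
  real-valued loses no generality, and \<open>Q \<ge> 0\<close> on the half-line is a consequence.
\<close>

definition lssp ::
    "'a measure \<Rightarrow> (real \<Rightarrow> 'a \<Rightarrow> complex) \<Rightarrow> real \<Rightarrow> (real \<Rightarrow> real) \<Rightarrow> (real \<Rightarrow> real) \<Rightarrow>
      (real \<Rightarrow> complex) \<Rightarrow> bool" where
  "lssp M X H q Q C \<longleftrightarrow>
     (\<forall>t>0. Q t = t powr (2 * H) * q (ln t)) \<and>
     continuous_on {0<..} Q \<and> (\<exists>t>0. Q t \<noteq> 0) \<and>
     continuous_on {0<..} C \<and> (\<exists>t>0. C t \<noteq> 0) \<and>
     mult_nonneg_definite C \<and> C 1 = 1 \<and>
     has_covariance M X (\<lambda>t s. of_real (Q (sqrt (t * s))) * C (t / s))"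

definition chirp_covariance ::
    "(real \<Rightarrow> real) \<Rightarrow> (real \<Rightarrow> complex) \<Rightarrow> real \<Rightarrow> real \<Rightarrow> real \<Rightarrow> real \<Rightarrow> complex" where
  "chirp_covariance Q C a b t s =
     of_real (Q (sqrt (t * s))) * C (t / s) *
       of_real (t / s) powr (\<i> * of_real (a * (ln (sqrt (t * s)) - b)))"

text \<open>
  The mean-square integral over a compact interval is the limit in quadratic mean of Riemann sums
  as the mesh tends to zero; over the half-line it is the limit in quadratic mean of the integrals
  over \<open>{u..v}\<close> as \<open>u\<close> tends to 0 and \<open>v\<close> to infinity.
\<close>

definition has_ms_integral_Icc ::
    "'a measure \<Rightarrow> (real \<Rightarrow> 'a \<Rightarrow> complex) \<Rightarrow> real \<Rightarrow> real \<Rightarrow> ('a \<Rightarrow> complex) \<Rightarrow> bool" where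
  "has_ms_integral_Icc M W u v I \<longleftrightarrow>
     second_order M I \<and> (\<forall>t\<in>{u..v}. second_order M (W t)) \<and>
     (\<forall>e>0. \<exists>d>0. \<forall>p. p tagged_division_of {u..v} \<and> (\<lambda>x. ball x d) fine p \<longrightarrow>
        (LINT \<omega>|M. (cmod ((\<Sum>(x, K)\<in>p. measure lborel K *\<^sub>R W x \<omega>) - I \<omega>))\<^sup>2) < e)"

definition has_ms_integral_pos ::
    "'a measure \<Rightarrow> (real \<Rightarrow> 'a \<Rightarrow> complex) \<Rightarrow> ('a \<Rightarrow> complex) \<Rightarrow> bool" where
  "has_ms_integral_pos M W I \<longleftrightarrow>
     second_order M I \<and>
     (\<exists>J. (\<forall>u v. 0 < u \<and> u \<le> v \<longrightarrow> has_ms_integral_Icc M W u v (J u v)) \<and>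
          ((\<lambda>(u, v). LINT \<omega>|M. (cmod (J u v \<omega> - I \<omega>))\<^sup>2) \<longlongrightarrow> 0) (at_right 0 \<times>\<^sub>F at_top))"

definition ambiguity_integrand ::
    "(real \<Rightarrow> 'a \<Rightarrow> complex) \<Rightarrow> real \<Rightarrow> real \<Rightarrow> real \<Rightarrow> 'a \<Rightarrow> complex" where
  "ambiguity_integrand Y \<theta> \<tau> t \<omega> =
     Y (t * sqrt \<tau>) \<omega> * cnj (Y (t / sqrt \<tau>) \<omega>) * of_real t powr (- (\<i> * of_real (2 * pi * \<theta>)) - 1)"

text \<open>
  A mean-square integral is unique only up to almost sure equality, and one version is chosen.
  The moments below do not depend on the choice.
\<close>

definition ambiguity ::
    "'a measure \<Rightarrow> (real \<Rightarrow> 'a \<Rightarrow> complex) \<Rightarrow> real \<Rightarrow> real \<Rightarrow> 'a \<Rightarrow> complex" where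
  "ambiguity M Y \<theta> \<tau> = (SOME A. has_ms_integral_pos M (ambiguity_integrand Y \<theta> \<tau>) A)"

definition expected_ambiguity ::
    "'a measure \<Rightarrow> (real \<Rightarrow> 'a \<Rightarrow> complex) \<Rightarrow> real \<Rightarrow> real \<Rightarrow> complex" where
  "expected_ambiguity M Y \<theta> \<tau> = integral\<^sup>L M (ambiguity M Y \<theta> \<tau>)"

definition ambiguity_power ::
    "'a measure \<Rightarrow> (real \<Rightarrow> 'a \<Rightarrow> complex) \<Rightarrow> real \<Rightarrow> real \<Rightarrow> real" where
  "ambiguity_power M Y \<theta> \<tau> = (LINT \<omega>|M. (cmod (ambiguity M Y \<theta> \<tau> \<omega>))\<^sup>2)"

definition ambiguity_support ::
    "'a measure \<Rightarrow> (real \<Rightarrow> 'a \<Rightarrow> complex) \<Rightarrow> (real \<times> real) set" where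
  "ambiguity_support M Y = {(\<theta>, \<tau>). \<tau> > 0 \<and> ambiguity_power M Y \<theta> \<tau> > 0}"

definition optimal_ambiguity_kernel ::
    "'a measure \<Rightarrow> (real \<Rightarrow> 'a \<Rightarrow> complex) \<Rightarrow> real \<Rightarrow> real \<Rightarrow> real" where
  "optimal_ambiguity_kernel M Y \<theta> \<tau> =
     (cmod (expected_ambiguity M Y \<theta> \<tau>))\<^sup>2 / ambiguity_power M Y \<theta> \<tau>
       * indicator (ambiguity_support M Y) (\<theta>, \<tau>)"

definition tf_kernel_integrand ::
    "'a measure \<Rightarrow> (real \<Rightarrow> 'a \<Rightarrow> complex) \<Rightarrow> real \<Rightarrow> real \<Rightarrow> real \<Rightarrow> real \<Rightarrow> complex" where
  "tf_kernel_integrand M Y t \<xi> \<theta> \<tau> =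
     of_real (optimal_ambiguity_kernel M Y \<theta> \<tau>)
       * of_real t powr (\<i> * of_real (2 * pi * \<theta>))
       * of_real \<tau> powr (- (\<i> * of_real (2 * pi * \<xi>)) - 1)"

definition optimal_tf_kernel ::
    "'a measure \<Rightarrow> (real \<Rightarrow> 'a \<Rightarrow> complex) \<Rightarrow> real \<Rightarrow> real \<Rightarrow> complex" where
  "optimal_tf_kernel M Y t \<xi> =
     (LINT \<tau>:{0<..}|lborel. (LINT \<theta>|lborel. tf_kernel_integrand M Y t \<xi> \<theta> \<tau>))"

definition ms_integrals_exist :: "'a measure \<Rightarrow> (real \<Rightarrow> 'a \<Rightarrow> complex) \<Rightarrow> bool" where
  "ms_integrals_exist M Y \<longleftrightarrow>
     (\<forall>\<theta>. \<forall>\<tau>>0. \<exists>A. has_ms_integral_pos M (ambiguity_integrand Y \<theta> \<tau>) A)"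

text \<open>
  Absolute convergence of the moment integrals, and interchange of expectation and integration in
  the first moment of the ambiguity function \<open>A\<close> and in the second moment, where \<open>\<bar>A\<bar>\<^sup>2\<close> is written
  as \<open>A * cnj A\<close>, a double integral.
\<close>

definition expectation_interchange :: "'a measure \<Rightarrow> (real \<Rightarrow> 'a \<Rightarrow> complex) \<Rightarrow> bool" where
  "expectation_interchange M Y \<longleftrightarrow>
     (\<forall>\<theta>. \<forall>\<tau>>0.
        set_integrable lborel {0<..} (\<lambda>t. LINT \<omega>|M. ambiguity_integrand Y \<theta> \<tau> t \<omega>) \<and>
        expected_ambiguity M Y \<theta> \<tau> =
          (LINT t:{0<..}|lborel. (LINT \<omega>|M. ambiguity_integrand Y \<theta> \<tau> t \<omega>)) \<and>
        set_integrable (lborel \<Otimes>\<^sub>M lborel) ({0<..} \<times> {0<..})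
          (\<lambda>(t, s). LINT \<omega>|M. ambiguity_integrand Y \<theta> \<tau> t \<omega> * cnj (ambiguity_integrand Y \<theta> \<tau> s \<omega>)) \<and>
        of_real (ambiguity_power M Y \<theta> \<tau>) =
          (LINT t:{0<..}|lborel. (LINT s:{0<..}|lborel. (LINT \<omega>|M.
             ambiguity_integrand Y \<theta> \<tau> t \<omega> * cnj (ambiguity_integrand Y \<theta> \<tau> s \<omega>)))))"

definition tf_kernel_converges :: "'a measure \<Rightarrow> (real \<Rightarrow> 'a \<Rightarrow> complex) \<Rightarrow> bool" where
  "tf_kernel_converges M Y \<longleftrightarrow>
     (\<forall>t>0. \<forall>\<xi>. set_integrable (lborel \<Otimes>\<^sub>M lborel) ({0<..} \<times> UNIV)
        (\<lambda>(\<tau>, \<theta>). tf_kernel_integrand M Y t \<xi> \<theta> \<tau>))"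

end

theory Submission
  imports Defs
begin

text \<open>
  The chirp factor is a coboundary: with \<open>g t = a * ((ln t)\<^sup>2 / 2 - b * ln t)\<close> it equals
  \<open>exp (\<i> * (g t - g s))\<close>, so \<open>Z\<close> has the covariance of \<open>X' t = exp (\<i> * g t) * X t\<close>. The fourth
  moments of a circularly symmetric Gaussian process depend only on its covariance, so the first two
  moments of the ambiguity function of \<open>Z\<close> are those of \<open>X'\<close>. Since
  \<open>g (t * sqrt \<tau>) - g (t / sqrt \<tau>) = a * ln \<tau> * (ln t - b)\<close>, the modulation shifts \<open>\<theta>\<close> by
  \<open>a * ln \<tau> / (2 * pi)\<close>, up to a factor of modulus one that depends on \<open>\<tau>\<close> only. Undoing this shift
  in the integral over \<open>\<theta>\<close> produces the factor \<open>exp (\<i> * a * ln \<tau> * ln t)\<close>, which is the shift of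
  \<open>\<xi>\<close> by \<open>a / (2 * pi) * ln t\<close>.
\<close>

section \<open>Fourth moments of real Gaussian variables\<close>

text \<open>A centred normal density with deviation \<open>\<sigma>\<close> has second moment
  \<open>\<sigma> ^ 2\<close> and fourth moment \<open>3 * \<sigma> ^ 4\<close>. A centred point
  mass is zero almost everywhere, so both sides vanish.\<close>

lemma gaussian_rv_moments:
  assumes M: "prob_space M" and W: "gaussian_rv M W" and mean: "integral\<^sup>L M W = 0"
  shows "integrable M (\<lambda>\<omega>. W \<omega> ^ 4)"
    and "(LINT \<omega>|M. W \<omega> ^ 4) = 3 * (LINT \<omega>|M. (W \<omega>)\<^sup>2)\<^sup>2"
proof -
  interpret prob_space M by (rule M)
  have [measurable]: "W \<in> borel_measurable M"
    using W by (simp add: gaussian_rv_def)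
  consider (normal) \<mu> \<sigma> where "\<sigma> > 0" "distributed M lborel W (normal_density \<mu> \<sigma>)"
    | (const) \<mu> where "AE \<omega> in M. W \<omega> = \<mu>"
    using W unfolding gaussian_rv_def by blast
  then have "integrable M (\<lambda>\<omega>. W \<omega> ^ 4) \<and>
    (LINT \<omega>|M. W \<omega> ^ 4) = 3 * (LINT \<omega>|M. (W \<omega>)\<^sup>2)\<^sup>2"
  proof cases
    case normal
    have "\<mu> = 0"
      using normal_distributed_expectation[OF normal] mean by simp
    then have D: "distributed M lborel W (normal_density 0 \<sigma>)"
      using normal by simp
    have "has_bochner_integral lborel (\<lambda>x. normal_density 0 \<sigma> x * (x - 0) ^ (2 * 2))
        (fact (2 * 2) / ((2 / \<sigma>\<^sup>2) ^ 2 * fact 2))"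
      by (rule normal_moment_even[OF normal(1)])
    \<comment> \<open>The constant is \<open>24 / ((2 / \<sigma> ^ 2) ^ 2 * 2)\<close>.\<close>
    then have 4: "has_bochner_integral lborel (\<lambda>x. normal_density 0 \<sigma> x * x ^ 4) (3 * \<sigma> ^ 4)"
      by (simp add: fact_numeral power_divide)
    have "has_bochner_integral lborel (\<lambda>x. normal_density 0 \<sigma> x * (x - 0) ^ (2 * 1))
        (fact (2 * 1) / ((2 / \<sigma>\<^sup>2) ^ 1 * fact 1))"
      by (rule normal_moment_even[OF normal(1)])
    then have 2: "has_bochner_integral lborel (\<lambda>x. normal_density 0 \<sigma> x * x\<^sup>2) (\<sigma>\<^sup>2)"
      by simp
    have "integrable M (\<lambda>\<omega>. W \<omega> ^ 4)"
      using distributed_integrable[OF D, of "\<lambda>x. x ^ 4"] 4 by (simp add: has_bochner_integral_iff)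
    moreover have "(LINT \<omega>|M. W \<omega> ^ 4) = 3 * \<sigma> ^ 4"
      using distributed_integral[OF D, of "\<lambda>x. x ^ 4"] 4 by (simp add: has_bochner_integral_iff)
    moreover have "(LINT \<omega>|M. (W \<omega>)\<^sup>2) = \<sigma>\<^sup>2"
      using distributed_integral[OF D, of "\<lambda>x. x\<^sup>2"] 2 by (simp add: has_bochner_integral_iff)
    ultimately show ?thesis by simp
  next
    case const
    then have "integral\<^sup>L M W = \<mu>"
      using integral_cong_AE[of W M "\<lambda>_. \<mu>"] by (simp add: prob_space)
    then have 0: "AE \<omega> in M. W \<omega> = 0"
      using const mean by simp
    have "integrable M (\<lambda>\<omega>. W \<omega> ^ 4) \<longleftrightarrow> integrable M (\<lambda>_. 0 :: real)"
      using 0 by (intro integrable_cong_AE) auto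
    moreover have "(LINT \<omega>|M. W \<omega> ^ 4) = (LINT \<omega>|M. 0)" "(LINT \<omega>|M. (W \<omega>)\<^sup>2) = (LINT \<omega>|M. 0)"
      using 0 by (intro integral_cong_AE; auto)+
    ultimately show ?thesis by simp
  qed
  then show "integrable M (\<lambda>\<omega>. W \<omega> ^ 4)"
    and "(LINT \<omega>|M. W \<omega> ^ 4) = 3 * (LINT \<omega>|M. (W \<omega>)\<^sup>2)\<^sup>2" by auto
qed

section \<open>Square-integrable variables\<close>

lemma second_order_cnj:
  assumes "second_order M V"
  shows "second_order M (\<lambda>\<omega>. cnj (V \<omega>))"
proof -
  have "cnj \<in> borel_measurable borel"
    by (intro borel_measurable_continuous_onI continuous_intros)
  then have "(\<lambda>\<omega>. cnj (V \<omega>)) \<in> borel_measurable M"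
    using assms by (intro measurable_compose[of V M borel cnj]) (simp_all add: second_order_def)
  then show ?thesis
    using assms by (simp add: second_order_def)
qed

lemma second_order_cmult: "second_order M V \<Longrightarrow> second_order M (\<lambda>\<omega>. c * V \<omega>)"
  by (auto simp: second_order_def norm_mult power_mult_distrib)

lemma integrable_mult_second_order:
  assumes "second_order M V" and "second_order M W"
  shows "integrable M (\<lambda>\<omega>. V \<omega> * W \<omega>)"
proof (rule Bochner_Integration.integrable_bound)
  show "integrable M (\<lambda>\<omega>. (cmod (V \<omega>))\<^sup>2 + (cmod (W \<omega>))\<^sup>2)"
    using assms by (simp add: second_order_def)
  show "(\<lambda>\<omega>. V \<omega> * W \<omega>) \<in> borel_measurable M"
    using assms by (auto simp: second_order_def)
  have "x * y \<le> x\<^sup>2 + y\<^sup>2" if "x \<ge> 0" "y \<ge> 0" for x y :: real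
    using sum_squares_bound[of x y] that mult_nonneg_nonneg[OF that] by linarith
  then show "AE \<omega> in M. norm (V \<omega> * W \<omega>) \<le> norm ((cmod (V \<omega>))\<^sup>2 + (cmod (W \<omega>))\<^sup>2)"
    by (simp add: norm_mult)
qed

lemma (in prob_space) integrable_second_order:
  assumes "second_order M V"
  shows "integrable M V"
  using integrable_mult_second_order[OF assms, of "\<lambda>_. 1"] by (simp add: second_order_def)

section \<open>Circularly symmetric Gaussian processes\<close>

text \<open>Proper complex Gaussian processes: the last clause is a vanishing pseudo-covariance.
  This extracts from circular symmetry the two moment conditions on which the fourth moments
  rest.\<close>

definition proper_gaussian :: "'a measure \<Rightarrow> (real \<Rightarrow> 'a \<Rightarrow> complex) \<Rightarrow> bool" where
  "proper_gaussian M Y \<longleftrightarrow> prob_space M \<and> gaussian_process M Y \<and>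
     (\<forall>t>0. second_order M (Y t) \<and> integral\<^sup>L M (Y t) = 0) \<and>
     (\<forall>t>0. \<forall>s>0. (LINT \<omega>|M. Y t \<omega> * Y s \<omega>) = 0)"

text \<open>Both sides are integrals of \<open>f\<close> against path laws, and circular symmetry
  makes these laws equal.\<close>

lemma circularly_symmetric_integral:
  fixes f :: "(real \<Rightarrow> complex) \<Rightarrow> complex"
  assumes "circularly_symmetric M Y" and \<alpha>: "\<alpha> \<in> {0..<2 * pi}"
    and f: "f \<in> borel_measurable (\<Pi>\<^sub>M t\<in>{0<..}. borel)"
  shows "(LINT \<omega>|M. f (\<lambda>t\<in>{0<..}. exp (\<i> * of_real \<alpha>) * Y t \<omega>)) =
    (LINT \<omega>|M. f (\<lambda>t\<in>{0<..}. Y t \<omega>))"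
proof -
  have [measurable]: "Y t \<in> borel_measurable M" if "t > 0" for t
    using assms that by (simp add: circularly_symmetric_def)
  have 1: "(\<lambda>\<omega>. \<lambda>t\<in>{0<..}. exp (\<i> * of_real \<alpha>) * Y t \<omega>) \<in> measurable M (\<Pi>\<^sub>M t\<in>{0<..}. borel)"
    by (intro measurable_restrict) simp
  have 2: "(\<lambda>\<omega>. \<lambda>t\<in>{0<..}. Y t \<omega>) \<in> measurable M (\<Pi>\<^sub>M t\<in>{0<..}. borel)"
    by (intro measurable_restrict) simp
  have "process_law M (\<lambda>t \<omega>. exp (\<i> * of_real \<alpha>) * Y t \<omega>) = process_law M Y"
    using assms by (simp add: circularly_symmetric_def)
  then show ?thesis
    using integral_distr[OF 1 f] integral_distr[OF 2 f] by (simp add: process_law_def)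
qed

text \<open>Rotation by \<open>pi\<close> turns \<open>Y\<close> into its negative, so the mean
  equals its own negative. Rotation by \<open>pi / 2\<close> multiplies \<open>Y t * Y s\<close> by
  -1, so the pseudo-covariance does too.\<close>

lemma proper_gaussianI:
  assumes "prob_space M" and "gaussian_process M Y" and circ: "circularly_symmetric M Y"
    and so: "\<And>t. t > 0 \<Longrightarrow> second_order M (Y t)"
  shows "proper_gaussian M Y"
proof -
  have "integral\<^sup>L M (Y t) = 0" if t: "t > 0" for t
  proof -
    have "(\<lambda>x. x t) \<in> borel_measurable (\<Pi>\<^sub>M t\<in>{0<..}. (borel :: complex measure))"
      using t by simp
    from circularly_symmetric_integral[OF circ _ this, of pi] show ?thesis
      using t by (simp add: mult.commute[of \<i>])
  qed
  moreover have "(LINT \<omega>|M. Y t \<omega> * Y s \<omega>) = 0" if t: "t > 0" and s: "s > 0" for t s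
  proof -
    have m: "(\<lambda>x. x t * x s) \<in> borel_measurable (\<Pi>\<^sub>M t\<in>{0<..}. (borel :: complex measure))"
      using t s by simp
    have "exp (\<i> * of_real (pi / 2)) = \<i>"
      using cis_conv_exp[of "pi / 2"] by simp
    then have "(LINT \<omega>|M. (\<i> * Y t \<omega>) * (\<i> * Y s \<omega>)) = (LINT \<omega>|M. Y t \<omega> * Y s \<omega>)"
      using circularly_symmetric_integral[OF circ _ m, of "pi / 2"] t s by simp
    moreover have "(\<lambda>\<omega>. (\<i> * Y t \<omega>) * (\<i> * Y s \<omega>)) = (\<lambda>\<omega>. - (Y t \<omega> * Y s \<omega>))"
      by (simp add: fun_eq_iff algebra_simps flip: power2_eq_square)
    ultimately show ?thesis by simp
  qed
  ultimately show ?thesis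
    using assms by (simp add: proper_gaussian_def)
qed

lemma proper_gaussian_covariance:
  assumes "proper_gaussian M Y" "t > 0" "s > 0"
  shows "covariance M Y t s = (LINT \<omega>|M. Y t \<omega> * cnj (Y s \<omega>))"
  using assms by (simp add: proper_gaussian_def covariance_def)

text \<open>The deterministic factor \<open>k\<close> is absorbed into the coefficients of each
  linear combination, and it leaves the pseudo-covariance as a scalar multiple of zero.\<close>

lemma proper_gaussian_modulate:
  assumes Y: "proper_gaussian M Y"
  shows "proper_gaussian M (\<lambda>t \<omega>. k t * Y t \<omega>)"
proof -
  have "gaussian_rv M (\<lambda>\<omega>. Re (\<Sum>t\<in>S. c t * (k t * Y t \<omega>)))" if "finite S" "S \<subseteq> {0<..}" for S c
  proof -
    have "\<forall>S c. finite S \<and> S \<subseteq> {0<..} \<longrightarrow> gaussian_rv M (\<lambda>\<omega>. Re (\<Sum>t\<in>S. c t * Y t \<omega>))"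
      using Y by (simp add: proper_gaussian_def gaussian_process_def)
    from this[rule_format, of S "\<lambda>t. c t * k t"] that show ?thesis
      by (simp only: mult.assoc simp_thms)
  qed
  moreover have "(LINT \<omega>|M. (k t * Y t \<omega>) * (k s * Y s \<omega>)) = 0" if "t > 0" "s > 0" for t s
  proof -
    have "(\<lambda>\<omega>. (k t * Y t \<omega>) * (k s * Y s \<omega>)) = (\<lambda>\<omega>. (k t * k s) * (Y t \<omega> * Y s \<omega>))"
      by (simp add: fun_eq_iff ac_simps)
    then show ?thesis
      using Y that by (simp add: proper_gaussian_def)
  qed
  ultimately show ?thesis
    using Y by (simp add: proper_gaussian_def gaussian_process_def second_order_cmult)
qed

text \<open>For a complex sum \<open>z\<close> the square of \<open>Re z\<close> is half the real
  part of \<open>z * z + z * cnj z\<close>. The first term has mean zero because the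
  pseudo-covariance vanishes, so the variance of \<open>W\<close> is half the Hermitian form of the
  covariance.\<close>

lemma proper_gaussian_linear_moments:
  fixes c :: "real \<Rightarrow> complex"
  assumes Y: "proper_gaussian M Y" and S: "finite S" "S \<subseteq> {0<..}"
  defines "W \<equiv> \<lambda>\<omega>. Re (\<Sum>t\<in>S. c t * Y t \<omega>)"
  shows "integrable M (\<lambda>\<omega>. W \<omega> ^ 4)"
    and "(LINT \<omega>|M. W \<omega> ^ 4) =
      3 * (Re (\<Sum>t\<in>S. \<Sum>s\<in>S. c t * cnj (c s) * covariance M Y t s) / 2)\<^sup>2"
proof -
  interpret prob_space M using Y by (simp add: proper_gaussian_def)
  have so: "second_order M (Y t)" if "t \<in> S" for t
    using Y S that by (auto simp: proper_gaussian_def)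
  have "(LINT \<omega>|M. W \<omega>) = Re (LINT \<omega>|M. (\<Sum>t\<in>S. c t * Y t \<omega>))"
    unfolding W_def using integrable_second_order[OF so] by (intro integral_Re) simp
  also have "(LINT \<omega>|M. (\<Sum>t\<in>S. c t * Y t \<omega>)) = (\<Sum>t\<in>S. c t * (LINT \<omega>|M. Y t \<omega>))"
    using integrable_second_order[OF so] by simp
  also have "\<dots> = 0"
    using Y S by (intro sum.neutral) (auto simp: proper_gaussian_def)
  finally have mean: "(LINT \<omega>|M. W \<omega>) = 0" by simp
  have YY: "integrable M (\<lambda>\<omega>. Y t \<omega> * Y s \<omega>)" if "t \<in> S" "s \<in> S" for t s
    by (intro integrable_mult_second_order so that)
  have YcY: "integrable M (\<lambda>\<omega>. Y t \<omega> * cnj (Y s \<omega>))" if "t \<in> S" "s \<in> S" for t s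
    by (intro integrable_mult_second_order second_order_cnj so that)
  have Re2: "(Re z)\<^sup>2 = Re (z * z + z * cnj z) / 2" for z
    by (simp add: power2_eq_square)
  have "(W \<omega>)\<^sup>2 = Re ((\<Sum>t\<in>S. \<Sum>s\<in>S. c t * c s * (Y t \<omega> * Y s \<omega>)) +
      (\<Sum>t\<in>S. \<Sum>s\<in>S. c t * cnj (c s) * (Y t \<omega> * cnj (Y s \<omega>)))) / 2" for \<omega>
    unfolding W_def Re2 cnj_sum sum_product by (simp add: ac_simps)
  then have "(LINT \<omega>|M. (W \<omega>)\<^sup>2) =
    (LINT \<omega>|M. Re ((\<Sum>t\<in>S. \<Sum>s\<in>S. c t * c s * (Y t \<omega> * Y s \<omega>)) +
      (\<Sum>t\<in>S. \<Sum>s\<in>S. c t * cnj (c s) * (Y t \<omega> * cnj (Y s \<omega>))))) / 2"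
    by (simp only: integral_divide_zero)
  also have "(LINT \<omega>|M. Re ((\<Sum>t\<in>S. \<Sum>s\<in>S. c t * c s * (Y t \<omega> * Y s \<omega>)) +
      (\<Sum>t\<in>S. \<Sum>s\<in>S. c t * cnj (c s) * (Y t \<omega> * cnj (Y s \<omega>))))) =
    Re (LINT \<omega>|M. (\<Sum>t\<in>S. \<Sum>s\<in>S. c t * c s * (Y t \<omega> * Y s \<omega>)) +
      (\<Sum>t\<in>S. \<Sum>s\<in>S. c t * cnj (c s) * (Y t \<omega> * cnj (Y s \<omega>))))"
    by (intro integral_Re Bochner_Integration.integrable_add Bochner_Integration.integrable_sum
        integrable_mult_right YY YcY)
  also have "(LINT \<omega>|M. (\<Sum>t\<in>S. \<Sum>s\<in>S. c t * c s * (Y t \<omega> * Y s \<omega>)) +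
      (\<Sum>t\<in>S. \<Sum>s\<in>S. c t * cnj (c s) * (Y t \<omega> * cnj (Y s \<omega>)))) =
    (\<Sum>t\<in>S. \<Sum>s\<in>S. c t * c s * (LINT \<omega>|M. Y t \<omega> * Y s \<omega>)) +
      (\<Sum>t\<in>S. \<Sum>s\<in>S. c t * cnj (c s) * (LINT \<omega>|M. Y t \<omega> * cnj (Y s \<omega>)))"
    by (subst Bochner_Integration.integral_add)
      (auto intro!: Bochner_Integration.integrable_sum integrable_mult_right YY YcY
        simp: YY YcY Bochner_Integration.integral_sum)
  also have "(\<Sum>t\<in>S. \<Sum>s\<in>S. c t * c s * (LINT \<omega>|M. Y t \<omega> * Y s \<omega>)) = 0"
    using Y S by (intro sum.neutral ballI) (auto simp: proper_gaussian_def subset_iff)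
  also have "(\<Sum>t\<in>S. \<Sum>s\<in>S. c t * cnj (c s) * (LINT \<omega>|M. Y t \<omega> * cnj (Y s \<omega>))) =
    (\<Sum>t\<in>S. \<Sum>s\<in>S. c t * cnj (c s) * covariance M Y t s)"
    using S by (intro sum.cong refl) (auto simp: proper_gaussian_covariance[OF Y] subset_iff)
  finally have var: "(LINT \<omega>|M. (W \<omega>)\<^sup>2) =
      Re (\<Sum>t\<in>S. \<Sum>s\<in>S. c t * cnj (c s) * covariance M Y t s) / 2"
    by simp
  have "gaussian_rv M W"
    using Y S by (simp add: proper_gaussian_def gaussian_process_def W_def)
  from gaussian_rv_moments[OF prob_space_axioms this mean]
  show "integrable M (\<lambda>\<omega>. W \<omega> ^ 4)"
    and "(LINT \<omega>|M. W \<omega> ^ 4) =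
      3 * (Re (\<Sum>t\<in>S. \<Sum>s\<in>S. c t * cnj (c s) * covariance M Y t s) / 2)\<^sup>2"
    by (simp_all add: var)
qed

section \<open>Mixed fourth moments by polarization\<close>

text \<open>Integrability is bundled with the equality so that the relation is closed under linear
  operations: a non-integrable function has integral 0 by default, and linearity fails
  there.\<close>

definition same_mean ::
    "'a measure \<Rightarrow> ('a \<Rightarrow> 'c) \<Rightarrow> 'b measure \<Rightarrow> ('b \<Rightarrow> 'c::{banach, second_countable_topology}) \<Rightarrow> bool"
  where "same_mean M f N g \<longleftrightarrow> integrable M f \<and> integrable N g \<and> integral\<^sup>L M f = integral\<^sup>L N g"

lemma same_mean_add:
  "same_mean M f N g \<Longrightarrow> same_mean M f' N g' \<Longrightarrow>
    same_mean M (\<lambda>x. f x + f' x) N (\<lambda>x. g x + g' x)"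
  by (simp add: same_mean_def)

lemma same_mean_diff:
  "same_mean M f N g \<Longrightarrow> same_mean M f' N g' \<Longrightarrow>
    same_mean M (\<lambda>x. f x - f' x) N (\<lambda>x. g x - g' x)"
  by (simp add: same_mean_def)

lemma same_mean_cmult:
  fixes c :: "'c::{real_normed_field, banach, second_countable_topology}"
  shows "same_mean M f N g \<Longrightarrow> same_mean M (\<lambda>x. c * f x) N (\<lambda>x. c * g x)"
  by (simp add: same_mean_def)

lemma same_mean_of_real:
  "same_mean M f N g \<Longrightarrow> same_mean M (\<lambda>x. complex_of_real (f x)) N (\<lambda>x. of_real (g x))"
  by (simp add: same_mean_def)

text \<open>Since \<open>Re (\<i> * z) = - Im z\<close>, both \<open>z\<close> and
  \<open>cnj z\<close> are combinations of \<open>Re (1 * z)\<close> and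
  \<open>Re (\<i> * z)\<close>. One application turns one real factor of a product into a complex
  one.\<close>

lemma same_mean_mult_complex:
  assumes "\<And>c. same_mean M (\<lambda>x. of_real (Re (c * f x)) * f' x) N (\<lambda>x. of_real (Re (c * g x)) * g' x)"
  shows "same_mean M (\<lambda>x. f x * f' x) N (\<lambda>x. g x * g' x)"
    and "same_mean M (\<lambda>x. cnj (f x) * f' x) N (\<lambda>x. cnj (g x) * g' x)"
proof -
  have *: "z * w = of_real (Re (1 * z)) * w - \<i> * (of_real (Re (\<i> * z)) * w)"
    "cnj z * w = of_real (Re (1 * z)) * w + \<i> * (of_real (Re (\<i> * z)) * w)" for z w
    by (simp_all add: complex_eq_iff algebra_simps)
  show "same_mean M (\<lambda>x. f x * f' x) N (\<lambda>x. g x * g' x)"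
    using same_mean_diff[OF assms[of 1] same_mean_cmult[OF assms[of \<i>], of \<i>]]
    by (simp only: *(1)[symmetric])
  show "same_mean M (\<lambda>x. cnj (f x) * f' x) N (\<lambda>x. cnj (g x) * g' x)"
    using same_mean_add[OF assms[of 1] same_mean_cmult[OF assms[of \<i>], of \<i>]]
    by (simp only: *(2)[symmetric])
qed

text \<open>
  For a real linear combination \<open>W\<close> the fourth moment is \<open>3 * (E W\<^sup>2)\<^sup>2\<close>, hence a function of the
  covariance; polarization extends this to mixed fourth moments.
\<close>

lemma proper_gaussian_fourth_moment:
  assumes Y: "proper_gaussian M Y" and Z: "proper_gaussian N Z"
    and cov: "\<And>t s. t > 0 \<Longrightarrow> s > 0 \<Longrightarrow> covariance M Y t s = covariance N Z t s"
    and pos: "p > 0" "q > 0" "u > 0" "v > 0"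
  shows "(LINT \<omega>|M. Y p \<omega> * cnj (Y q \<omega>) * (cnj (Y u \<omega>) * Y v \<omega>)) =
    (LINT \<omega>|N. Z p \<omega> * cnj (Z q \<omega>) * (cnj (Z u \<omega>) * Z v \<omega>))"
proof -
  have fourth: "same_mean M (\<lambda>\<omega>. (Re (c1 * Y p \<omega>) + Re (c2 * Y q \<omega>) + Re (c3 * Y u \<omega>) + Re (c4 * Y v \<omega>)) ^ 4)
    N (\<lambda>\<omega>. (Re (c1 * Z p \<omega>) + Re (c2 * Z q \<omega>) + Re (c3 * Z u \<omega>) + Re (c4 * Z v \<omega>)) ^ 4)"
    for c1 c2 c3 c4
  proof -
    define S where "S = {p, q, u, v}"
    have S: "finite S" "S \<subseteq> {0<..}"
      using pos by (auto simp: S_def)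
    \<comment> \<open>The four times may coincide; the coefficients belonging to a repeated time
      then add up.\<close>
    define c where "c t = (if t = p then c1 else 0) + (if t = q then c2 else 0) +
      (if t = u then c3 else 0) + (if t = v then c4 else 0)" for t
    have *: "Re (\<Sum>t\<in>S. c t * f t) = Re (c1 * f p) + Re (c2 * f q) + Re (c3 * f u) + Re (c4 * f v)" for f
    proof -
      have "(\<Sum>t\<in>S. c t * f t) = (\<Sum>t\<in>S. if t = p then c1 * f t else 0) + (\<Sum>t\<in>S. if t = q then c2 * f t else 0) +
        (\<Sum>t\<in>S. if t = u then c3 * f t else 0) + (\<Sum>t\<in>S. if t = v then c4 * f t else 0)"
        unfolding sum.distrib[symmetric] by (rule sum.cong) (auto simp: c_def algebra_simps)
      \<comment> \<open>The single-point sums collapse while \<open>S\<close> is opaque; unfolding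
        \<open>S\<close> afterwards settles membership.\<close>
      then show ?thesis by (simp add: S(1)) (simp add: S_def)
    qed
    have "(\<Sum>t\<in>S. \<Sum>s\<in>S. c t * cnj (c s) * covariance M Y t s) =
      (\<Sum>t\<in>S. \<Sum>s\<in>S. c t * cnj (c s) * covariance N Z t s)"
      using S by (intro sum.cong refl) (auto simp: cov subset_iff)
    then show ?thesis
      using proper_gaussian_linear_moments[OF Y S, of c] proper_gaussian_linear_moments[OF Z S, of c]
      by (simp only: same_mean_def *)
  qed
  \<comment> \<open>Signed sum over the 8 sign choices for \<open>x2\<close>, \<open>x3\<close>,
    \<open>x4\<close>, each weighted by the product of its signs. Only the monomial
    \<open>x1 * x2 * x3 * x4\<close> is odd in all three; its coefficient 24 in each power gives the
    total 8 * 24 = 192.\<close>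
  define pol :: "real \<Rightarrow> real \<Rightarrow> real \<Rightarrow> real \<Rightarrow> real" where "pol x1 x2 x3 x4 = 1 / 192 *
    ((x1 + x2 + x3 + x4) ^ 4 - (x1 + x2 + x3 - x4) ^ 4 - (x1 + x2 - x3 + x4) ^ 4
      - (x1 - x2 + x3 + x4) ^ 4 + (x1 + x2 - x3 - x4) ^ 4 + (x1 - x2 + x3 - x4) ^ 4
      + (x1 - x2 - x3 + x4) ^ 4 - (x1 - x2 - x3 - x4) ^ 4)" for x1 x2 x3 x4
  have pol: "pol x1 x2 x3 x4 = x1 * (x2 * (x3 * x4))" for x1 x2 x3 x4
    by (simp add: pol_def power4_eq_xxxx algebra_simps)
  have "same_mean M (\<lambda>\<omega>. pol (Re (c1 * Y p \<omega>)) (Re (c2 * Y q \<omega>)) (Re (c3 * Y u \<omega>)) (Re (c4 * Y v \<omega>)))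
    N (\<lambda>\<omega>. pol (Re (c1 * Z p \<omega>)) (Re (c2 * Z q \<omega>)) (Re (c3 * Z u \<omega>)) (Re (c4 * Z v \<omega>)))"
    for c1 c2 c3 c4
    unfolding pol_def
    \<comment> \<open>Each sign choice is realized by negating coefficients.\<close>
    using fourth[of c1 c2 c3 c4] fourth[of c1 c2 c3 "- c4"] fourth[of c1 c2 "- c3" c4]
      fourth[of c1 "- c2" c3 c4] fourth[of c1 c2 "- c3" "- c4"] fourth[of c1 "- c2" c3 "- c4"]
      fourth[of c1 "- c2" "- c3" c4] fourth[of c1 "- c2" "- c3" "- c4"]
    by (intro same_mean_cmult same_mean_diff same_mean_add)
      (simp_all only: mult_minus_left uminus_complex.sel diff_conv_add_uminus)
  then have real: "same_mean M (\<lambda>\<omega>. Re (c1 * Y p \<omega>) * (Re (c2 * Y q \<omega>) * (Re (c3 * Y u \<omega>) * Re (c4 * Y v \<omega>))))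
    N (\<lambda>\<omega>. Re (c1 * Z p \<omega>) * (Re (c2 * Z q \<omega>) * (Re (c3 * Z u \<omega>) * Re (c4 * Z v \<omega>))))"
    for c1 c2 c3 c4
    by (simp only: pol)
  \<comment> \<open>The real factors become complex one at a time, in the order \<open>v\<close>,
    \<open>u\<close>, \<open>q\<close>, \<open>p\<close>, with conjugates at \<open>u\<close> and
    \<open>q\<close>; each round first moves the next factor to the front.\<close>
  have "same_mean M (\<lambda>\<omega>. of_real (Re (c4 * Y v \<omega>)) *
      (of_real (Re (c1 * Y p \<omega>)) * (of_real (Re (c2 * Y q \<omega>)) * of_real (Re (c3 * Y u \<omega>)))))
    N (\<lambda>\<omega>. of_real (Re (c4 * Z v \<omega>)) *
      (of_real (Re (c1 * Z p \<omega>)) * (of_real (Re (c2 * Z q \<omega>)) * complex_of_real (Re (c3 * Z u \<omega>)))))"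
    for c1 c2 c3 c4
    using same_mean_of_real[OF real[of c1 c2 c3 c4]] by (simp only: of_real_mult ac_simps)
  note 1 = same_mean_mult_complex(1)[OF this]
  have "same_mean M (\<lambda>\<omega>. of_real (Re (c3 * Y u \<omega>)) *
      (of_real (Re (c1 * Y p \<omega>)) * (of_real (Re (c2 * Y q \<omega>)) * Y v \<omega>)))
    N (\<lambda>\<omega>. of_real (Re (c3 * Z u \<omega>)) *
      (of_real (Re (c1 * Z p \<omega>)) * (of_real (Re (c2 * Z q \<omega>)) * Z v \<omega>)))"
    for c1 c2 c3
    using 1[of c1 c2 c3] by (simp only: ac_simps)
  note 2 = same_mean_mult_complex(2)[OF this]
  have "same_mean M (\<lambda>\<omega>. of_real (Re (c2 * Y q \<omega>)) *
      (of_real (Re (c1 * Y p \<omega>)) * (cnj (Y u \<omega>) * Y v \<omega>)))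
    N (\<lambda>\<omega>. of_real (Re (c2 * Z q \<omega>)) *
      (of_real (Re (c1 * Z p \<omega>)) * (cnj (Z u \<omega>) * Z v \<omega>)))"
    for c1 c2
    using 2[of c1 c2] by (simp only: ac_simps)
  note 3 = same_mean_mult_complex(2)[OF this]
  have "same_mean M (\<lambda>\<omega>. of_real (Re (c1 * Y p \<omega>)) * (cnj (Y q \<omega>) * (cnj (Y u \<omega>) * Y v \<omega>)))
    N (\<lambda>\<omega>. of_real (Re (c1 * Z p \<omega>)) * (cnj (Z q \<omega>) * (cnj (Z u \<omega>) * Z v \<omega>)))"
    for c1
    using 3[of c1] by (simp only: ac_simps)
  from same_mean_mult_complex(1)[OF this] show ?thesis
    by (simp add: same_mean_def mult.assoc)
qed

section \<open>The chirp as a phase modulation\<close>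

lemma of_real_powr_imaginary:
  assumes "x > 0"
  shows "complex_of_real x powr (\<i> * of_real r) = cis (r * ln x)"
    and "complex_of_real x powr (- (\<i> * of_real r) - 1) = cis (- r * ln x) / of_real x"
proof -
  have ln: "ln (complex_of_real x) = of_real (ln x)" and x: "exp (of_real (ln x)) = complex_of_real x"
    using assms by (simp_all add: Ln_of_real exp_of_real)
  show "complex_of_real x powr (\<i> * of_real r) = cis (r * ln x)"
    using assms by (simp add: powr_def ln cis_conv_exp mult.assoc)
  have "(- (\<i> * of_real r) - 1) * of_real (ln x) = \<i> * of_real (- r * ln x) - of_real (ln x)"
    by (simp add: algebra_simps)
  then show "complex_of_real x powr (- (\<i> * of_real r) - 1) = cis (- r * ln x) / of_real x"
    using assms by (simp only: powr_def ln exp_diff x cis_conv_exp) simp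
qed

text \<open>A quadratic phase in \<open>ln t\<close>, whose derivative with respect to
  \<open>ln t\<close> is \<open>a * (ln t - b)\<close>: a linear chirp in logarithmic time.\<close>

definition chirp_phase :: "real \<Rightarrow> real \<Rightarrow> real \<Rightarrow> real" where
  "chirp_phase a b t = a * ((ln t)\<^sup>2 / 2 - b * ln t)"

text \<open>With \<open>x = ln t\<close> and \<open>y = ln s\<close> the exponent is
  \<open>a * ((x + y) / 2 - b) * (x - y)\<close>, a difference of squares that splits into a term in
  \<open>t\<close> minus the same term in \<open>s\<close>.\<close>

lemma chirp_covariance_eq:
  assumes "t > 0" "s > 0"
  shows "chirp_covariance Q C a b t s =
    cis (chirp_phase a b t) * cnj (cis (chirp_phase a b s)) *
      (of_real (Q (sqrt (t * s))) * C (t / s))"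
proof -
  have "a * (ln (sqrt (t * s)) - b) * ln (t / s) = chirp_phase a b t - chirp_phase a b s"
    using assms by (simp add: ln_sqrt ln_mult ln_div chirp_phase_def field_simps power2_eq_square)
  moreover have "t / s > 0" using assms by simp
  ultimately show ?thesis
    unfolding chirp_covariance_def of_real_powr_imaginary(1)[OF \<open>t / s > 0\<close>]
    by (simp add: cis_cnj cis_mult)
qed

text \<open>The quadratic terms in \<open>ln t\<close> cancel. What remains is affine in
  \<open>ln t\<close>, so it acts on the ambiguity integrand as a shift of
  \<open>\<theta>\<close>.\<close>

lemma chirp_phase_diff:
  assumes "t > 0" "\<tau> > 0"
  shows "chirp_phase a b (t * sqrt \<tau>) - chirp_phase a b (t / sqrt \<tau>) = a * ln \<tau> * (ln t - b)"
  using assms by (simp add: ln_sqrt ln_mult ln_div chirp_phase_def field_simps power2_eq_square)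

section \<open>From the ambiguity domain to the time-frequency domain\<close>

text \<open>For each fixed \<open>\<tau>\<close> the inner integral over \<open>\<theta>\<close> is
  translation invariant, so the shift may depend on \<open>\<tau>\<close>.\<close>

lemma optimal_tf_kernel_shift:
  assumes t: "t > 0"
    and eq: "\<And>\<theta> \<tau>. \<tau> > 0 \<Longrightarrow> optimal_ambiguity_kernel N Z \<theta> \<tau> =
      optimal_ambiguity_kernel M X (\<theta> - a * ln \<tau> / (2 * pi)) \<tau>"
  shows "optimal_tf_kernel N Z t \<xi> = optimal_tf_kernel M X t (\<xi> - a / (2 * pi) * ln t)"
  unfolding optimal_tf_kernel_def
proof (rule set_lebesgue_integral_cong; (intro allI impI)?)
  fix \<tau> :: real assume "\<tau> \<in> {0<..}"
  then have \<tau>: "\<tau> > 0" by simp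
  have "tf_kernel_integrand N Z t \<xi> (a * ln \<tau> / (2 * pi) + 1 * \<theta>) \<tau> =
      tf_kernel_integrand M X t (\<xi> - a / (2 * pi) * ln t) \<theta> \<tau>" for \<theta>
  proof -
    \<comment> \<open>Translating \<open>\<theta>\<close> leaves the extra phase
      \<open>a * ln \<tau> * ln t\<close>, symmetric in the roles of \<open>t\<close> and
      \<open>\<tau>\<close>, so it can be charged to \<open>\<xi>\<close> instead.\<close>
    have "2 * pi * (a * ln \<tau> / (2 * pi) + \<theta>) * ln t + - (2 * pi * \<xi>) * ln \<tau> =
      2 * pi * \<theta> * ln t + - (2 * pi * (\<xi> - a / (2 * pi) * ln t)) * ln \<tau>"
      by (simp add: field_simps)
    then show ?thesis
      unfolding tf_kernel_integrand_def of_real_powr_imaginary[OF t] of_real_powr_imaginary[OF \<tau>]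
      by (simp add: eq[OF \<tau>] cis_mult mult.assoc)
  qed
  then show "(LINT \<theta>|lborel. tf_kernel_integrand N Z t \<xi> \<theta> \<tau>) =
      (LINT \<theta>|lborel. tf_kernel_integrand M X t (\<xi> - a / (2 * pi) * ln t) \<theta> \<tau>)"
    by (subst lborel_integral_real_affine[where c = 1 and t = "a * ln \<tau> / (2 * pi)"]) simp_all
qed simp

section \<open>Ambiguity moments of the chirped process\<close>

theorem theorem9:
  fixes M :: "'a measure" and N :: "'b measure"
    and X :: "real \<Rightarrow> 'a \<Rightarrow> complex" and Z :: "real \<Rightarrow> 'b \<Rightarrow> complex"
    and Q q :: "real \<Rightarrow> real" and C :: "real \<Rightarrow> complex" and H a b :: real
  assumes "prob_space M" and "prob_space N"
    and "lssp M X H q Q C"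
    and "circularly_symmetric M X" and "gaussian_process M X"
    and "has_covariance N Z (chirp_covariance Q C a b)"
    and "circularly_symmetric N Z" and "gaussian_process N Z"
    and "ms_integrals_exist M X" and "expectation_interchange M X" and "tf_kernel_converges M X"
    and "ms_integrals_exist N Z" and "expectation_interchange N Z" and "tf_kernel_converges N Z"
  shows "\<forall>t>0. \<forall>\<xi>. optimal_tf_kernel N Z t \<xi> = optimal_tf_kernel M X t (\<xi> - a / (2 * pi) * ln t)"
proof -
  have X: "proper_gaussian M X"
    using assms by (intro proper_gaussianI) (auto simp: lssp_def has_covariance_def)
  have Z: "proper_gaussian N Z"
    using assms by (intro proper_gaussianI) (auto simp: has_covariance_def)
  define k where "k t = cis (chirp_phase a b t)" for t
  \<comment> \<open>\<open>X'\<close> lives on the space of \<open>X\<close>: it is tied to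
    \<open>X\<close> pointwise, and to \<open>Z\<close> only through the covariance.\<close>
  define X' where "X' t \<omega> = k t * X t \<omega>" for t \<omega>
  have X': "proper_gaussian M X'"
    unfolding X'_def by (rule proper_gaussian_modulate[OF X])
  have cov_X': "covariance M X' t s = k t * cnj (k s) * covariance M X t s"
    if "t > 0" "s > 0" for t s
  proof -
    have "(\<lambda>\<omega>. X' t \<omega> * cnj (X' s \<omega>)) = (\<lambda>\<omega>. k t * cnj (k s) * (X t \<omega> * cnj (X s \<omega>)))"
      by (simp add: X'_def fun_eq_iff)
    then show ?thesis
      using that by (simp add: proper_gaussian_covariance[OF X] proper_gaussian_covariance[OF X'])
  qed
  have cov: "covariance M X' t s = covariance N Z t s" if "t > 0" "s > 0" for t s
    using assms that
    by (simp add: cov_X' lssp_def has_covariance_def chirp_covariance_eq k_def)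
  define sh where "sh \<theta> \<tau> = \<theta> - a * ln \<tau> / (2 * pi)" for \<theta> \<tau> :: real
  \<comment> \<open>The part \<open>a * ln \<tau> * ln t\<close> of the phase difference merges with
    the Mellin weight and turns \<open>\<theta>\<close> into \<open>sh \<theta> \<tau>\<close>; the
    part with \<open>b\<close> is constant in \<open>t\<close>.\<close>
  have kk: "k (t * sqrt \<tau>) * cnj (k (t / sqrt \<tau>)) * of_real t powr (- (\<i> * of_real (2 * pi * \<theta>)) - 1) =
      cis (- a * b * ln \<tau>) * of_real t powr (- (\<i> * of_real (2 * pi * sh \<theta> \<tau>)) - 1)"
    if "t > 0" "\<tau> > 0" for t \<theta> \<tau>
  proof -
    have "chirp_phase a b (t * sqrt \<tau>) - chirp_phase a b (t / sqrt \<tau>) + - (2 * pi * \<theta>) * ln t =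
      - a * b * ln \<tau> + - (2 * pi * sh \<theta> \<tau>) * ln t"
      unfolding chirp_phase_diff[OF that] by (simp add: sh_def field_simps)
    then show ?thesis
      unfolding of_real_powr_imaginary(2)[OF that(1)] by (simp add: k_def cis_cnj cis_mult)
  qed
  have first: "(LINT \<omega>|N. ambiguity_integrand Z \<theta> \<tau> t \<omega>) =
      cis (- a * b * ln \<tau>) * (LINT \<omega>|M. ambiguity_integrand X (sh \<theta> \<tau>) \<tau> t \<omega>)"
    if t: "t > 0" and \<tau>: "\<tau> > 0" for \<theta> \<tau> t
  proof -
    have pos: "t * sqrt \<tau> > 0" "t / sqrt \<tau> > 0" using that by simp_all
    have "(LINT \<omega>|N. ambiguity_integrand Z \<theta> \<tau> t \<omega>) =
      covariance N Z (t * sqrt \<tau>) (t / sqrt \<tau>) * of_real t powr (- (\<i> * of_real (2 * pi * \<theta>)) - 1)"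
      unfolding ambiguity_integrand_def by (simp add: proper_gaussian_covariance[OF Z pos])
    also have "\<dots> = covariance M X (t * sqrt \<tau>) (t / sqrt \<tau>) *
        (k (t * sqrt \<tau>) * cnj (k (t / sqrt \<tau>)) * of_real t powr (- (\<i> * of_real (2 * pi * \<theta>)) - 1))"
      unfolding cov[OF pos, symmetric] cov_X'[OF pos] by (simp only: ac_simps)
    also have "\<dots> = cis (- a * b * ln \<tau>) * (LINT \<omega>|M. ambiguity_integrand X (sh \<theta> \<tau>) \<tau> t \<omega>)"
      unfolding kk[OF that] ambiguity_integrand_def by (simp add: proper_gaussian_covariance[OF X pos])
    finally show ?thesis .
  qed
  have second: "(LINT \<omega>|N. ambiguity_integrand Z \<theta> \<tau> t \<omega> * cnj (ambiguity_integrand Z \<theta> \<tau> s \<omega>)) =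
      (LINT \<omega>|M. ambiguity_integrand X (sh \<theta> \<tau>) \<tau> t \<omega> * cnj (ambiguity_integrand X (sh \<theta> \<tau>) \<tau> s \<omega>))"
    if t: "t > 0" and s: "s > 0" and \<tau>: "\<tau> > 0" for \<theta> \<tau> t s
  proof -
    define w where "w \<theta> t = of_real t powr (- (\<i> * of_real (2 * pi * \<theta>)) - 1)" for \<theta> t :: real
    have pos: "t * sqrt \<tau> > 0" "t / sqrt \<tau> > 0" "s * sqrt \<tau> > 0" "s / sqrt \<tau> > 0"
      using that by simp_all
    \<comment> \<open>Generic in the sample space, so that it applies on both \<open>M\<close> and
      \<open>N\<close>; the factors are arranged as in the fourth-moment lemma.\<close>
    have *: "ambiguity_integrand Y \<theta> \<tau> t \<omega> * cnj (ambiguity_integrand Y \<theta> \<tau> s \<omega>) =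
      w \<theta> t * cnj (w \<theta> s) * (Y (t * sqrt \<tau>) \<omega> * cnj (Y (t / sqrt \<tau>) \<omega>) *
        (cnj (Y (s * sqrt \<tau>) \<omega>) * Y (s / sqrt \<tau>) \<omega>))"
      for Y :: "real \<Rightarrow> 'c \<Rightarrow> complex" and \<theta> \<omega>
      by (simp add: ambiguity_integrand_def w_def ac_simps)
    \<comment> \<open>The constant phase depends on \<open>\<tau>\<close> alone, so it meets its own
      conjugate and cancels.\<close>
    have "k (t * sqrt \<tau>) * cnj (k (t / sqrt \<tau>)) * w \<theta> t *
        cnj (k (s * sqrt \<tau>) * cnj (k (s / sqrt \<tau>)) * w \<theta> s) =
      w (sh \<theta> \<tau>) t * cnj (w (sh \<theta> \<tau>) s) * (cis (- a * b * ln \<tau>) * cnj (cis (- a * b * ln \<tau>)))"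
      unfolding w_def kk[OF t \<tau>] kk[OF s \<tau>] by (simp only: complex_cnj_mult ac_simps)
    also have "\<dots> = w (sh \<theta> \<tau>) t * cnj (w (sh \<theta> \<tau>) s)"
      by (simp add: cis_cnj cis_mult)
    finally have kw: "k (t * sqrt \<tau>) * cnj (k (t / sqrt \<tau>)) * w \<theta> t *
        cnj (k (s * sqrt \<tau>) * cnj (k (s / sqrt \<tau>)) * w \<theta> s) = w (sh \<theta> \<tau>) t * cnj (w (sh \<theta> \<tau>) s)" .
    have "w \<theta> t * cnj (w \<theta> s) * (X' (t * sqrt \<tau>) \<omega> * cnj (X' (t / sqrt \<tau>) \<omega>) *
        (cnj (X' (s * sqrt \<tau>) \<omega>) * X' (s / sqrt \<tau>) \<omega>)) =
      w (sh \<theta> \<tau>) t * cnj (w (sh \<theta> \<tau>) s) * (X (t * sqrt \<tau>) \<omega> * cnj (X (t / sqrt \<tau>) \<omega>) *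
        (cnj (X (s * sqrt \<tau>) \<omega>) * X (s / sqrt \<tau>) \<omega>))" for \<omega>
      unfolding kw[symmetric] X'_def by (simp only: complex_cnj_mult complex_cnj_cnj ac_simps)
    then have "(LINT \<omega>|M. ambiguity_integrand X' \<theta> \<tau> t \<omega> * cnj (ambiguity_integrand X' \<theta> \<tau> s \<omega>)) =
      (LINT \<omega>|M. ambiguity_integrand X (sh \<theta> \<tau>) \<tau> t \<omega> * cnj (ambiguity_integrand X (sh \<theta> \<tau>) \<tau> s \<omega>))"
      unfolding * by (simp only:)
    moreover have "(LINT \<omega>|M. ambiguity_integrand X' \<theta> \<tau> t \<omega> * cnj (ambiguity_integrand X' \<theta> \<tau> s \<omega>)) =
      (LINT \<omega>|N. ambiguity_integrand Z \<theta> \<tau> t \<omega> * cnj (ambiguity_integrand Z \<theta> \<tau> s \<omega>))"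
      unfolding * integral_mult_right_zero
      using proper_gaussian_fourth_moment[OF X' Z cov pos] by simp
    ultimately show ?thesis by simp
  qed
  \<comment> \<open>The interchange assumptions for \<open>Z\<close> and \<open>X\<close> replace
    the chosen versions of the ambiguity functions by deterministic integrals, which are compared
    pointwise.\<close>
  have "expected_ambiguity N Z \<theta> \<tau> = cis (- a * b * ln \<tau>) * expected_ambiguity M X (sh \<theta> \<tau>) \<tau>"
    if \<tau>: "\<tau> > 0" for \<theta> \<tau>
  proof -
    have "expected_ambiguity N Z \<theta> \<tau> = (LINT t:{0<..}|lborel. (LINT \<omega>|N. ambiguity_integrand Z \<theta> \<tau> t \<omega>))"
      using assms(13) \<tau> by (simp add: expectation_interchange_def)
    also have "\<dots> = (LINT t:{0<..}|lborel.
        cis (- a * b * ln \<tau>) * (LINT \<omega>|M. ambiguity_integrand X (sh \<theta> \<tau>) \<tau> t \<omega>))"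
      using \<tau> by (intro set_lebesgue_integral_cong allI impI first) auto
    also have "\<dots> = cis (- a * b * ln \<tau>) * expected_ambiguity M X (sh \<theta> \<tau>) \<tau>"
      using assms(10) \<tau> by (simp add: expectation_interchange_def)
    finally show ?thesis .
  qed
  then have expected: "cmod (expected_ambiguity N Z \<theta> \<tau>) = cmod (expected_ambiguity M X (sh \<theta> \<tau>) \<tau>)"
    if "\<tau> > 0" for \<theta> \<tau>
    using that by (simp add: norm_mult)
  have power: "ambiguity_power N Z \<theta> \<tau> = ambiguity_power M X (sh \<theta> \<tau>) \<tau>" if \<tau>: "\<tau> > 0" for \<theta> \<tau>
  proof -
    have "complex_of_real (ambiguity_power N Z \<theta> \<tau>) =
      (LINT t:{0<..}|lborel. (LINT s:{0<..}|lborel. (LINT \<omega>|N.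
         ambiguity_integrand Z \<theta> \<tau> t \<omega> * cnj (ambiguity_integrand Z \<theta> \<tau> s \<omega>))))"
      using assms(13) \<tau> by (simp add: expectation_interchange_def)
    also have "\<dots> = (LINT t:{0<..}|lborel. (LINT s:{0<..}|lborel. (LINT \<omega>|M.
         ambiguity_integrand X (sh \<theta> \<tau>) \<tau> t \<omega> * cnj (ambiguity_integrand X (sh \<theta> \<tau>) \<tau> s \<omega>))))"
      using \<tau> by (intro set_lebesgue_integral_cong allI impI second) auto
    also have "\<dots> = of_real (ambiguity_power M X (sh \<theta> \<tau>) \<tau>)"
      using assms(10) \<tau> by (simp add: expectation_interchange_def)
    finally show ?thesis by (simp only: of_real_eq_iff)
  qed
  \<comment> \<open>The kernel sees only the modulus of the mean and the power, so the constant
    phase disappears; the support moves along with the power.\<close>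
  have "optimal_ambiguity_kernel N Z \<theta> \<tau> = optimal_ambiguity_kernel M X (\<theta> - a * ln \<tau> / (2 * pi)) \<tau>"
    if "\<tau> > 0" for \<theta> \<tau>
    unfolding optimal_ambiguity_kernel_def sh_def[symmetric]
    using that by (simp add: expected power ambiguity_support_def indicator_def)
  then show ?thesis
    using optimal_tf_kernel_shift by blast
qed

end
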